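(* Let $m>0$, $p>0$, $m+p=1$, $a\in(0,1)$, and let $\phi(\xi)=\phi(x-ct)$ be a finite traveling wave solution, with speed $c>0$ and profile vanishing on a left half-line, of $$u_t=\frac1{m+1}(u^{m+1})_{xx}+u^p(1-u)(u-a).\qquad(\mathrm{E})$$ For $w\in\mathbb{R}$ let $\phi_w$ be the translate of the profile $\phi$ normalized so that $\phi_w(\xi)=0$ for $\xi\le w$ and $w$ is the left endpoint of its support, and let $\tilde\phi_w(\xi):=\phi_w(-\xi)$. Then, for any $w_1,w_2\in\mathbb{R}$ with $w_1+w_2>0$, the function $$\Phi_{w_1,w_2}(t,x):=\phi_{w_1}(x-ct)+\tilde\phi_{w_2}(x+ct)$$ is a weak solution of (E).
   Context: Weak solution of $u_t=d(u^{m+1})_{xx}+f(u)$, $d=1/(m+1)$, with initial datum $u_0\in C^0(\mathbb{R})$, $0\le u_0\le1$: a nonnegative $u$ such that for each $r,T>0$, with $Q_T=(0,T)\times\mathbb{R}$, $u\in C(Q_T)\cap L^\infty(Q_T)$ and $$\int_0^T\!\!\int_{-r}^r\{u\phi_t+d\,u^{m+1}\phi_{xx}+f(u)\phi\}dxdt=\int_{-r}^r\{u(T,x)\phi(T,x)-u_0(x)\phi(0,x)\}dx+d\int_0^T\{u^{m+1}(t,r)\phi_x(t,r)-u^{m+1}(t,-r)\phi_x(t,-r)\}dt$$ for all $\phi\in C^{2,1}(\overline{Q_T})$ with $\phi\ge0$, $\phi(t,\pm r)=0$ on $[0,T]$. A finite traveling wave solution with speed $c$ is a weak solution $u(t,x)=\phi(x-ct)$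 with $\phi(z)\equiv0$ for $z\ge w$ (or $z\le w$) for some $w\in\mathbb{R}$. *)

theory Defs
  imports "HOL-Analysis.Analysis"
begin

text \<open>
  Functions of time and space are curried, \<open>u t x\<close>; as elements of
  function spaces on \<open>Q T\<close> they are read as functions of the pair \<open>(t, x)\<close>.
\<close>

definition Q :: "real \<Rightarrow> (real \<times> real) set" where
  "Q T = {0<..<T} \<times> UNIV"

text \<open>
  The functions \<open>\<psi>t\<close>, \<open>\<psi>x\<close>, \<open>\<psi>xx\<close> are the partial derivatives of \<open>\<psi>\<close> on the closed
  strip; time derivatives at \<open>0\<close> and \<open>T\<close> are one-sided.
\<close>

definition C21 ::
    "real \<Rightarrow> (real \<Rightarrow> real \<Rightarrow> real) \<Rightarrow> (real \<Rightarrow> real \<Rightarrow> real) \<Rightarrow>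
     (real \<Rightarrow> real \<Rightarrow> real) \<Rightarrow> (real \<Rightarrow> real \<Rightarrow> real) \<Rightarrow> bool" where
  "C21 T \<psi> \<psi>t \<psi>x \<psi>xx \<longleftrightarrow>
     (\<forall>t\<in>{0..T}. \<forall>x.
        ((\<lambda>s. \<psi> s x) has_real_derivative \<psi>t t x) (at t within {0..T}) \<and>
        ((\<lambda>y. \<psi> t y) has_real_derivative \<psi>x t x) (at x) \<and>
        ((\<lambda>y. \<psi>x t y) has_real_derivative \<psi>xx t x) (at x)) \<and>
     continuous_on (closure (Q T)) (\<lambda>(t, x). \<psi> t x) \<and>
     continuous_on (closure (Q T)) (\<lambda>(t, x). \<psi>t t x) \<and>
     continuous_on (closure (Q T)) (\<lambda>(t, x). \<psi>x t x) \<and>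
     continuous_on (closure (Q T)) (\<lambda>(t, x). \<psi>xx t x)"

text \<open>
  As \<open>\<psi> \<ge> 0\<close> on the whole strip and \<open>\<psi>\<close> vanishes at \<open>x = \<plusminus>r\<close>, the slopes \<open>\<psi>x\<close> vanish
  there as well. Requiring \<open>\<psi> \<ge> 0\<close> only for \<open>\<bar>x\<bar> \<le> r\<close> gives an equivalent notion of weak
  solution, by multiplying \<open>\<psi>\<close> with cutoffs supported in \<open>\<bar>x\<bar> < r\<close> and passing to the limit.
\<close>

definition test_function ::
    "real \<Rightarrow> real \<Rightarrow> (real \<Rightarrow> real \<Rightarrow> real) \<Rightarrow> (real \<Rightarrow> real \<Rightarrow> real) \<Rightarrow>
     (real \<Rightarrow> real \<Rightarrow> real) \<Rightarrow> (real \<Rightarrow> real \<Rightarrow> real) \<Rightarrow> bool" where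
  "test_function r T \<psi> \<psi>t \<psi>x \<psi>xx \<longleftrightarrow>
     C21 T \<psi> \<psi>t \<psi>x \<psi>xx \<and>
     (\<forall>(t, x)\<in>closure (Q T). 0 \<le> \<psi> t x) \<and>
     (\<forall>t\<in>{0..T}. \<psi> t r = 0 \<and> \<psi> t (- r) = 0)"

text \<open>
  Weak solution of \<open>u\<^sub>t = d (u\<^sup>m\<^sup>+\<^sup>1)\<^sub>x\<^sub>x + f(u)\<close>, \<open>d = 1/(m+1)\<close>, with initial datum \<open>u0\<close>.
  All integrands below are bounded, and continuous up to the null set \<open>t = 0\<close>, so the
  gauge integrals exist and coincide with the Lebesgue integrals.
\<close>

definition weak_solution ::
    "real \<Rightarrow> (real \<Rightarrow> real) \<Rightarrow> (real \<Rightarrow> real) \<Rightarrow> (real \<Rightarrow> real \<Rightarrow> real) \<Rightarrow> bool" where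
  "weak_solution m f u0 u \<longleftrightarrow>
     continuous_on UNIV u0 \<and> (\<forall>x. 0 \<le> u0 x \<and> u0 x \<le> 1) \<and>
     (\<forall>t>0. \<forall>x. 0 \<le> u t x) \<and>
     (\<forall>r>0. \<forall>T>0.
        continuous_on (Q T) (\<lambda>(t, x). u t x) \<and>
        (\<exists>K. AE (t, x) in lborel. (t, x) \<in> Q T \<longrightarrow> \<bar>u t x\<bar> \<le> K) \<and>
        (\<forall>\<psi> \<psi>t \<psi>x \<psi>xx. test_function r T \<psi> \<psi>t \<psi>x \<psi>xx \<longrightarrow>
           integral {0..T} (\<lambda>t. integral {- r..r} (\<lambda>x.
              u t x * \<psi>t t x + 1 / (m + 1) * u t x powr (m + 1) * \<psi>xx t x
                + f (u t x) * \<psi> t x)) =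
           integral {- r..r} (\<lambda>x. u T x * \<psi> T x - u0 x * \<psi> 0 x)
           + 1 / (m + 1) * integral {0..T} (\<lambda>t.
              u t r powr (m + 1) * \<psi>x t r - u t (- r) powr (m + 1) * \<psi>x t (- r))))"

definition finite_traveling_wave ::
    "real \<Rightarrow> (real \<Rightarrow> real) \<Rightarrow> real \<Rightarrow> (real \<Rightarrow> real) \<Rightarrow> bool" where
  "finite_traveling_wave m f c \<phi> \<longleftrightarrow>
     weak_solution m f \<phi> (\<lambda>t x. \<phi> (x - c * t)) \<and>
     ((\<exists>w. \<forall>z\<ge>w. \<phi> z = 0) \<or> (\<exists>w. \<forall>z\<le>w. \<phi> z = 0))"

definition reaction :: "real \<Rightarrow> real \<Rightarrow> real \<Rightarrow> real" where
  "reaction p a u = u powr p * (1 - u) * (u - a)"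

definition fsupport :: "(real \<Rightarrow> real) \<Rightarrow> real set" where
  "fsupport \<phi> = closure {\<xi>. \<phi> \<xi> \<noteq> 0}"

text \<open>
  The translate of \<open>\<phi>\<close> whose support has left endpoint \<open>w\<close>; see the characterization
  below. The endpoint is meaningful for \<open>\<phi>\<close> not identically zero; for \<open>\<phi> = 0\<close> every
  translate is \<open>0\<close>.
\<close>

definition normalized :: "(real \<Rightarrow> real) \<Rightarrow> real \<Rightarrow> real \<Rightarrow> real" where
  "normalized \<phi> w \<xi> = \<phi> (\<xi> - w + Inf (fsupport \<phi>))"

lemma Inf_fsupport:
  assumes "\<exists>\<xi>. \<phi> \<xi> \<noteq> 0" and "\<forall>\<xi>\<le>w0. \<phi> \<xi> = 0"
  shows "Inf (fsupport \<phi>) = Inf {\<xi>. \<phi> \<xi> \<noteq> 0}" and "\<xi> < Inf (fsupport \<phi>) \<Longrightarrow> \<phi> \<xi> = 0"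
proof -
  let ?S = "{\<xi>. \<phi> \<xi> \<noteq> 0}"
  have ne: "?S \<noteq> {}" using assms(1) by auto
  have bdd: "bdd_below ?S"
    using assms(2) by (intro bdd_belowI[of _ w0]) (metis le_cases mem_Collect_eq)
  have "?S \<subseteq> {Inf ?S..}" using cInf_lower[OF _ bdd] by auto
  then have sub: "fsupport \<phi> \<subseteq> {Inf ?S..}"
    unfolding fsupport_def by (rule closure_minimal) simp
  have sup: "?S \<subseteq> fsupport \<phi>" unfolding fsupport_def by (rule closure_subset)
  show I: "Inf (fsupport \<phi>) = Inf ?S"
  proof (rule antisym)
    show "Inf (fsupport \<phi>) \<le> Inf ?S"
      using sub by (intro cInf_superset_mono ne sup bdd_belowI[of _ "Inf ?S"]) auto
    show "Inf ?S \<le> Inf (fsupport \<phi>)"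
      using sub sup ne by (intro cInf_greatest) auto
  qed
  show "\<phi> \<xi> = 0" if "\<xi> < Inf (fsupport \<phi>)"
    using that cInf_lower[OF _ bdd, of \<xi>] unfolding I by force
qed

lemma Inf_fsupport_translate:
  assumes "\<exists>\<xi>. \<phi> \<xi> \<noteq> 0" and "\<forall>\<xi>\<le>w0. \<phi> \<xi> = 0"
  shows "Inf (fsupport (\<lambda>\<xi>. \<phi> (\<xi> - s))) = Inf (fsupport \<phi>) + s"
proof -
  let ?S = "{\<xi>. \<phi> \<xi> \<noteq> 0}" and ?X = "\<lambda>\<xi>. \<phi> (\<xi> - s)"
  have ne: "?S \<noteq> {}" using assms(1) by auto
  have bdd: "bdd_below ?S"
    using assms(2) by (intro bdd_belowI[of _ w0]) (metis le_cases mem_Collect_eq)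
  obtain \<xi>0 where "\<phi> \<xi>0 \<noteq> 0" using assms(1) by blast
  then have x: "\<exists>\<xi>. ?X \<xi> \<noteq> 0" by (intro exI[of _ "\<xi>0 + s"]) simp
  have y: "\<forall>\<xi>\<le>w0 + s. ?X \<xi> = 0" using assms(2) by auto
  have im: "{\<xi>. ?X \<xi> \<noteq> 0} = (\<lambda>\<xi>. s + \<xi>) ` ?S"
  proof (intro equalityI subsetI)
    fix \<xi> assume "\<xi> \<in> {\<xi>. ?X \<xi> \<noteq> 0}"
    then show "\<xi> \<in> (\<lambda>\<xi>. s + \<xi>) ` ?S" by (intro image_eqI[of _ _ "\<xi> - s"]) auto
  qed auto
  have "Inf ((\<lambda>\<xi>. s + \<xi>) ` ?S) = s + Inf ?S"
  proof (rule cInf_eq_non_empty)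
    show "s + Inf ?S \<le> x" if "x \<in> (\<lambda>\<xi>. s + \<xi>) ` ?S" for x
      using that cInf_lower[OF _ bdd] by auto
    show "y \<le> s + Inf ?S" if lb: "\<And>x. x \<in> (\<lambda>\<xi>. s + \<xi>) ` ?S \<Longrightarrow> y \<le> x" for y
    proof -
      have "y - s \<le> Inf ?S"
        using ne lb by (intro cInf_greatest) (force simp: algebra_simps)+
      then show ?thesis by simp
    qed
  qed (use ne in auto)
  then show ?thesis
    using Inf_fsupport(1)[OF x y] Inf_fsupport(1)[OF assms] unfolding im by simp
qed

lemma normalized_characterization:
  assumes nz: "\<exists>\<xi>. \<phi> \<xi> \<noteq> 0" and left: "\<forall>\<xi>\<le>w0. \<phi> \<xi> = 0" and cont: "continuous_on UNIV \<phi>"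
  shows "\<eta> = normalized \<phi> w \<longleftrightarrow>
           (\<exists>s. \<forall>\<xi>. \<eta> \<xi> = \<phi> (\<xi> - s)) \<and> (\<forall>\<xi>\<le>w. \<eta> \<xi> = 0) \<and> Inf (fsupport \<eta>) = w"
proof
  let ?I = "Inf (fsupport \<phi>)"
  assume \<eta>: "\<eta> = normalized \<phi> w"
  have eq: "\<eta> = (\<lambda>\<xi>. \<phi> (\<xi> - (w - ?I)))"
    unfolding \<eta> normalized_def by (simp add: fun_eq_iff algebra_simps)
  have "closed {\<xi>. \<phi> \<xi> = 0}"
    using cont by (intro closed_Collect_eq) auto
  moreover have "{..<?I} \<subseteq> {\<xi>. \<phi> \<xi> = 0}"
    using Inf_fsupport(2)[OF nz left] by auto
  ultimately have "closure {..<?I} \<subseteq> {\<xi>. \<phi> \<xi> = 0}" by (rule closure_minimal[rotated])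
  then have "\<phi> \<xi> = 0" if "\<xi> \<le> ?I" for \<xi> using that by auto
  then have "\<forall>\<xi>\<le>w. \<eta> \<xi> = 0" unfolding eq by (simp add: algebra_simps)
  moreover have "Inf (fsupport \<eta>) = w"
    unfolding eq Inf_fsupport_translate[OF nz left] by simp
  ultimately show "(\<exists>s. \<forall>\<xi>. \<eta> \<xi> = \<phi> (\<xi> - s)) \<and> (\<forall>\<xi>\<le>w. \<eta> \<xi> = 0) \<and> Inf (fsupport \<eta>) = w"
    using fun_cong[OF eq] by blast
next
  assume "(\<exists>s. \<forall>\<xi>. \<eta> \<xi> = \<phi> (\<xi> - s)) \<and> (\<forall>\<xi>\<le>w. \<eta> \<xi> = 0) \<and> Inf (fsupport \<eta>) = w"
  then obtain s where s: "\<eta> = (\<lambda>\<xi>. \<phi> (\<xi> - s))" and "Inf (fsupport \<eta>) = w" by fast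
  then have "w = Inf (fsupport \<phi>) + s" using Inf_fsupport_translate[OF nz left] by simp
  then show "\<eta> = normalized \<phi> w" unfolding s normalized_def by (simp add: fun_eq_iff)
qed

definition reflected :: "(real \<Rightarrow> real) \<Rightarrow> real \<Rightarrow> real" where
  "reflected \<eta> \<xi> = \<eta> (- \<xi>)"

definition wave_pair ::
    "(real \<Rightarrow> real) \<Rightarrow> real \<Rightarrow> real \<Rightarrow> real \<Rightarrow> real \<Rightarrow> real \<Rightarrow> real" where
  "wave_pair \<phi> c w1 w2 t x =
     normalized \<phi> w1 (x - c * t) + reflected (normalized \<phi> w2) (x + c * t)"

end

theory Submission
  imports Defs
begin

text \<open>
  For \<open>t \<ge> 0\<close> the two waves have disjoint supports because \<open>w1 + w2 > 0\<close> and \<open>c > 0\<close>, and the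
  nonlinearities vanish at \<open>0\<close>, so the weak formulation of the sum is the sum of the weak
  formulations. Reflection in \<open>x\<close> preserves it. Translation in \<open>x\<close> needs an argument, since it
  moves the interval \<open>{-r..r}\<close> to some \<open>{A..B}\<close>: a test function \<open>\<psi>\<close> on \<open>{A..B}\<close> is multiplied
  by cutoffs \<open>h\<^sub>n(\<rho>)\<close>, \<open>\<rho> = (x - A)(B - x)\<close>, to become a test function on a larger symmetric
  interval. As \<open>\<psi>\<close> is nonnegative and vanishes at \<open>A\<close> and \<open>B\<close>, it is \<open>O(\<rho>\<^sup>2)\<close> with \<open>O(\<rho>)\<close> slope,
  which keeps all terms bounded, and dominated convergence applies.
\<close>

section \<open>Twice differentiable cutoffs with derivative bounds uniform in
  \<open>n\<close>\<close>

lemma DERIV_max_0_power: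
  "((\<lambda>y::real. max 0 y ^ Suc (Suc k)) has_real_derivative real (Suc (Suc k)) * max 0 y ^ Suc k) (at y)"
proof -
  consider "y < 0" | "y = 0" | "y > 0" by linarith
  then show ?thesis
  proof cases
    case 1
    have ev: "\<forall>\<^sub>F z in nhds y. max 0 z ^ Suc (Suc k) = (0::real)"
      using eventually_nhds_in_open[of "{..<0}" y] 1 by (auto elim!: eventually_mono)
    show ?thesis
      by (subst DERIV_cong_ev[OF refl ev refl]) (use 1 in auto)
  next
    case 2
    \<comment> \<open>Caratheodory criterion at the kink: the difference quotient is
      \<open>max 0 z ^ Suc k\<close>, which is continuous and vanishes at 0 because its exponent is
      at least 1.\<close>
    have "\<exists>g. (\<forall>z. max 0 z ^ Suc (Suc k) - max 0 (0::real) ^ Suc (Suc k) = g z * (z - 0)) \<and>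
        isCont g 0 \<and> g 0 = 0"
      by (intro exI[of _ "\<lambda>z. max 0 z ^ Suc k"] conjI allI continuous_intros) (auto simp: max_def)
    then have "((\<lambda>z::real. max 0 z ^ Suc (Suc k)) has_real_derivative 0) (at 0)"
      unfolding CARAT_DERIV by simp
    then show ?thesis using 2 by simp
  next
    case 3
    have ev: "\<forall>\<^sub>F z in nhds y. max 0 z ^ Suc (Suc k) = z ^ Suc (Suc k)"
      using eventually_nhds_in_open[of "{0<..}" y] 3 by (auto elim!: eventually_mono)
    show ?thesis
      by (subst DERIV_cong_ev[OF refl ev refl]) (use 3 DERIV_pow[of "Suc (Suc k)" y] in simp)
  qed
qed

text \<open>For y > 0 this is y^3 / (y^3 + e) with e = 1/(n+1), and it is 0 for y \<le> 0. The cube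
  is the smallest integer power that makes it twice continuously differentiable at 0. Since it
  depends only on y^3 / e, the quantities y h' and y^2 h'' have bounds independent of
  \<open>n\<close>.\<close>

definition cut :: "nat \<Rightarrow> real \<Rightarrow> real" where
  "cut n y = max 0 y ^ 3 / (max 0 y ^ 3 + inverse (real (Suc n)))"

definition cut1 :: "nat \<Rightarrow> real \<Rightarrow> real" where
  "cut1 n y = 3 * inverse (real (Suc n)) * max 0 y ^ 2 / (max 0 y ^ 3 + inverse (real (Suc n))) ^ 2"

definition cut2 :: "nat \<Rightarrow> real \<Rightarrow> real" where
  "cut2 n y = 6 * inverse (real (Suc n)) * max 0 y / (max 0 y ^ 3 + inverse (real (Suc n))) ^ 2
     - 18 * inverse (real (Suc n)) * max 0 y ^ 4 / (max 0 y ^ 3 + inverse (real (Suc n))) ^ 3"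

lemma cut_denominator_pos: "max 0 y ^ 3 + inverse (real (Suc n)) > 0"
  by (intro add_nonneg_pos) auto

lemma DERIV_cut: "(cut n has_real_derivative cut1 n y) (at y)"
proof -
  have d: "((\<lambda>y::real. max 0 y ^ 3) has_real_derivative 3 * max 0 y ^ 2) (at y)"
    using DERIV_max_0_power[of 1 y] by (simp add: eval_nat_numeral)
  show ?thesis
    unfolding cut_def cut1_def
    by (rule derivative_eq_intros d refl)+
      (use cut_denominator_pos[of y n] in \<open>auto simp: field_simps power2_eq_square\<close>)
qed

lemma DERIV_cut1: "(cut1 n has_real_derivative cut2 n y) (at y)"
proof -
  let ?P = "max 0 y" and ?e = "inverse (real (Suc n))"
  have d: "((\<lambda>y::real. max 0 y ^ 3) has_real_derivative 3 * max 0 y ^ 2) (at y)"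
    using DERIV_max_0_power[of 1 y] by (simp add: eval_nat_numeral)
  have d2: "((\<lambda>y::real. max 0 y ^ 2) has_real_derivative 2 * max 0 y) (at y)"
    using DERIV_max_0_power[of 0 y] by (simp add: eval_nat_numeral)
  \<comment> \<open>The quotient rule produces the denominator D^4; this identity brings the result
    to the two fractions of \<open>cut2\<close>.\<close>
  have alg: "((3 * e * (2 * P)) * D ^ 2 - 3 * e * P ^ 2 * (2 * (3 * P ^ 2) * D)) / (D ^ 2 * D ^ 2)
      = 6 * e * P / D ^ 2 - 18 * e * P ^ 4 / D ^ 3" if "D > 0" for D e P :: real
    using that by (simp add: divide_simps) (simp add: algebra_simps eval_nat_numeral)
  have "(cut1 n has_real_derivative
      ((3 * ?e * (2 * ?P)) * (?P ^ 3 + ?e) ^ 2 - 3 * ?e * ?P ^ 2 * (2 * (3 * ?P ^ 2) * (?P ^ 3 + ?e)))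
        / ((?P ^ 3 + ?e) ^ 2 * (?P ^ 3 + ?e) ^ 2)) (at y)"
    unfolding cut1_def
    by (rule derivative_eq_intros d d2 refl)+
      (use cut_denominator_pos[of y n] in \<open>auto simp: algebra_simps\<close>)
  then show ?thesis
    unfolding cut2_def alg[OF cut_denominator_pos] .
qed

lemma cut_nonpos: "y \<le> 0 \<Longrightarrow> cut n y = 0 \<and> cut1 n y = 0 \<and> cut2 n y = 0"
  by (simp add: cut_def cut1_def cut2_def max_def)

lemma cut_bounds: "0 \<le> cut n y" "cut n y \<le> 1"
  using cut_denominator_pos[of y n] by (auto simp: cut_def)

text \<open>\<open>y h' = 3h(1 - h)\<close> and \<open>y\<^sup>2 h'' = 6h(1 - h) - 18h\<^sup>2(1 - h)\<close> for \<open>h = cut n\<close>.\<close>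

lemma cut1_bound: "\<bar>y * cut1 n y\<bar> \<le> 3"
proof (cases "y \<le> 0")
  case False
  define e where "e = inverse (real (Suc n))"
  have e: "e > 0" "y > 0" using False by (auto simp: e_def)
  have D: "y ^ 3 + e > 0" using e by (intro add_pos_pos) auto
  have "y * cut1 n y = 3 * (cut n y * (1 - cut n y))"
    using e D unfolding cut1_def cut_def e_def[symmetric]
    by (simp add: divide_simps) (simp add: algebra_simps eval_nat_numeral)
  moreover have "\<bar>cut n y * (1 - cut n y)\<bar> \<le> 1 * 1"
    unfolding abs_mult using cut_bounds[of n y] by (intro mult_mono) auto
  ultimately show ?thesis by (simp add: abs_mult)
qed (simp add: cut_nonpos)

lemma cut2_bound: "\<bar>y ^ 2 * cut2 n y\<bar> \<le> 24"
proof (cases "y \<le> 0")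
  case False
  define e where "e = inverse (real (Suc n))"
  have e: "e > 0" "y > 0" using False by (auto simp: e_def)
  have D: "y ^ 3 + e > 0" using e by (intro add_pos_pos) auto
  have "y ^ 2 * cut2 n y = (6 - 18 * cut n y) * (cut n y * (1 - cut n y))"
    using e D unfolding cut2_def cut_def e_def[symmetric]
    by (simp add: divide_simps) (simp add: algebra_simps eval_nat_numeral)
  moreover have "\<bar>cut n y * (1 - cut n y)\<bar> \<le> 1 * 1"
    unfolding abs_mult using cut_bounds[of n y] by (intro mult_mono) auto
  then have "\<bar>6 - 18 * cut n y\<bar> * \<bar>cut n y * (1 - cut n y)\<bar> \<le> 24 * 1"
    using cut_bounds[of n y] by (intro mult_mono) auto
  ultimately show ?thesis by (simp add: abs_mult)
qed (simp add: cut_nonpos)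

text \<open>At a fixed y > 0 the parameter 1/(n+1) tends to 0 while the denominators stay away from
  0. The derivatives of the cutoff therefore leave no trace in the pointwise limit.\<close>

lemma cut_tendsto:
  assumes "y > 0"
  shows "(\<lambda>n. cut n y) \<longlonglongrightarrow> 1" "(\<lambda>n. cut1 n y) \<longlonglongrightarrow> 0" "(\<lambda>n. cut2 n y) \<longlonglongrightarrow> 0"
proof -
  have y: "max 0 y = y" "y \<noteq> 0" using assms by auto
  note L = LIMSEQ_inverse_real_of_nat
  have "(\<lambda>n. cut n y) \<longlonglongrightarrow> y ^ 3 / (y ^ 3 + 0)"
    unfolding cut_def y(1) by (intro tendsto_intros L) (use y in auto)
  then show "(\<lambda>n. cut n y) \<longlonglongrightarrow> 1" using y by simp
  have "(\<lambda>n. cut1 n y) \<longlonglongrightarrow> 3 * 0 * y ^ 2 / (y ^ 3 + 0) ^ 2"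
    unfolding cut1_def y(1) by (intro tendsto_intros L) (use y in auto)
  then show "(\<lambda>n. cut1 n y) \<longlonglongrightarrow> 0" by simp
  have "(\<lambda>n. cut2 n y) \<longlonglongrightarrow> 6 * 0 * y / (y ^ 3 + 0) ^ 2 - 18 * 0 * y ^ 4 / (y ^ 3 + 0) ^ 3"
    unfolding cut2_def y(1) by (intro tendsto_intros L) (use y in auto)
  then show "(\<lambda>n. cut2 n y) \<longlonglongrightarrow> 0" by simp
qed

lemma continuous_on_cut:
  "continuous_on S g \<Longrightarrow> continuous_on S (\<lambda>z. cut n (g z))"
  "continuous_on S g \<Longrightarrow> continuous_on S (\<lambda>z. cut1 n (g z))"
  "continuous_on S g \<Longrightarrow> continuous_on S (\<lambda>z. cut2 n (g z))"
  unfolding cut_def cut1_def cut2_def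
  by (intro continuous_intros; use cut_denominator_pos[of _ n] in \<open>force simp: less_le\<close>)+

section \<open>Dominated convergence on intervals and rectangles\<close>

text \<open>Pointwise convergence is asked for in the open interval only, as the endpoints form a
  null set. This matters for the cutoffs, which vanish at both endpoints for every \<open>n\<close>
  although they tend to 1 inside.\<close>

lemma interval_dominated_convergence:
  fixes F :: "nat \<Rightarrow> real \<Rightarrow> real"
  assumes cont: "\<And>n. continuous_on {A..B} (F n)"
    and bound: "\<And>n x. x \<in> {A..B} \<Longrightarrow> \<bar>F n x\<bar> \<le> M"
    and lim: "\<And>x. x \<in> {A<..<B} \<Longrightarrow> (\<lambda>n. F n x) \<longlonglongrightarrow> G x"
  shows "(\<lambda>n. integral {A..B} (F n)) \<longlonglongrightarrow> integral {A..B} G"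
  unfolding integral_open_interval_real
proof (rule dominated_convergence(2)[where h = "\<lambda>_. M"])
  show "F n integrable_on {A<..<B}" for n
    using integrable_continuous_real[OF cont[of n]] by (simp add: integrable_on_open_interval_real)
  show "(\<lambda>_. M) integrable_on {A<..<B}"
    using integrable_const_ivl[of M A B] by (simp add: integrable_on_open_interval_real)
qed (use bound lim in auto)

text \<open>Dominated convergence is used twice: in \<open>x\<close> for fixed \<open>t\<close>,
  then in \<open>t\<close> for the inner integrals, which are continuous in \<open>t\<close> and
  bounded by \<open>M * (B - A)\<close>.\<close>

lemma iterated_dominated_convergence:
  fixes F :: "nat \<Rightarrow> real \<Rightarrow> real \<Rightarrow> real"
  assumes cont: "\<And>n. continuous_on ({a..b} \<times> {A..B}) (\<lambda>(t, x). F n t x)"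
    and bound: "\<And>n t x. t \<in> {a..b} \<Longrightarrow> x \<in> {A..B} \<Longrightarrow> \<bar>F n t x\<bar> \<le> M"
    and lim: "\<And>t x. t \<in> {a..b} \<Longrightarrow> x \<in> {A<..<B} \<Longrightarrow> (\<lambda>n. F n t x) \<longlonglongrightarrow> G t x"
    and "A \<le> B"
  shows "(\<lambda>n. integral {a..b} (\<lambda>t. integral {A..B} (F n t)))
           \<longlonglongrightarrow> integral {a..b} (\<lambda>t. integral {A..B} (G t))"
proof (rule interval_dominated_convergence[where M = "M * (B - A)"])
  have c: "continuous_on {A..B} (F n t)" if "t \<in> {a..b}" for n t
    by (rule continuous_on_compose2[OF cont[of n], of _ "\<lambda>x. (t, x)", simplified])
      (use that in \<open>auto intro!: continuous_intros\<close>)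
  show "continuous_on {a..b} (\<lambda>t. integral {A..B} (F n t))" for n
    using integral_continuous_on_param[of "{a..b}" A B "F n"] cont[of n] by auto
  show "\<bar>integral {A..B} (F n t)\<bar> \<le> M * (B - A)" if "t \<in> {a..b}" for n t
    using integral_bound[OF \<open>A \<le> B\<close> c[OF that, of n], of M] bound that by auto
  show "(\<lambda>n. integral {A..B} (F n t)) \<longlonglongrightarrow> integral {A..B} (G t)" if "t \<in> {a<..<b}" for t
    by (rule interval_dominated_convergence[OF c bound lim]) (use that in auto)
qed

lemma integral_zero_outside:
  fixes g :: "real \<Rightarrow> real"
  assumes "\<And>x. x \<notin> {A..B} \<Longrightarrow> g x = 0" and "C \<le> A" and "B \<le> D"
  shows "integral {C..D} g = integral {A..B} g"
proof -
  have "g = (\<lambda>x. if x \<in> {A..B} then g x else 0)" using assms(1) by auto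
  then show ?thesis
    using Henstock_Kurzweil_Integration.integral_restrict_Int[of "{C..D}" "{A..B}" g] assms(2,3)
    by (simp add: Int_absorb2)
qed

section \<open>The weak formulation without lateral boundary terms\<close>

definition integrand ::
    "real \<Rightarrow> (real \<Rightarrow> real) \<Rightarrow> (real \<Rightarrow> real \<Rightarrow> real) \<Rightarrow> (real \<Rightarrow> real \<Rightarrow> real) \<Rightarrow>
     (real \<Rightarrow> real \<Rightarrow> real) \<Rightarrow> (real \<Rightarrow> real \<Rightarrow> real) \<Rightarrow> real \<Rightarrow> real \<Rightarrow> real" where
  "integrand m f u \<psi> \<psi>t \<psi>xx t x =
     u t x * \<psi>t t x + 1 / (m + 1) * u t x powr (m + 1) * \<psi>xx t x + f (u t x) * \<psi> t x"

text \<open>The lateral boundary term is left out because it vanishes for admissible test functions,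
  and \<open>u 0\<close> takes the place of the initial datum. The endpoints are arbitrary so that
  translated intervals can be expressed.\<close>

definition balance ::
    "real \<Rightarrow> (real \<Rightarrow> real) \<Rightarrow> (real \<Rightarrow> real \<Rightarrow> real) \<Rightarrow> real \<Rightarrow> real \<Rightarrow> real \<Rightarrow>
     (real \<Rightarrow> real \<Rightarrow> real) \<Rightarrow> (real \<Rightarrow> real \<Rightarrow> real) \<Rightarrow> (real \<Rightarrow> real \<Rightarrow> real) \<Rightarrow> bool" where
  "balance m f u A B T \<psi> \<psi>t \<psi>xx \<longleftrightarrow>
     integral {0..T} (\<lambda>t. integral {A..B} (integrand m f u \<psi> \<psi>t \<psi>xx t)) =
     integral {A..B} (\<lambda>x. u T x * \<psi> T x - u 0 x * \<psi> 0 x)"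

definition admissible ::
    "real \<Rightarrow> real \<Rightarrow> real \<Rightarrow> (real \<Rightarrow> real \<Rightarrow> real) \<Rightarrow> (real \<Rightarrow> real \<Rightarrow> real) \<Rightarrow>
     (real \<Rightarrow> real \<Rightarrow> real) \<Rightarrow> (real \<Rightarrow> real \<Rightarrow> real) \<Rightarrow> bool" where
  "admissible A B T \<psi> \<psi>t \<psi>x \<psi>xx \<longleftrightarrow>
     C21 T \<psi> \<psi>t \<psi>x \<psi>xx \<and> (\<forall>t\<in>{0..T}. \<forall>x. 0 \<le> \<psi> t x) \<and>
     (\<forall>t\<in>{0..T}. \<psi> t A = 0 \<and> \<psi> t B = 0)"

definition weak_identity :: "real \<Rightarrow> (real \<Rightarrow> real) \<Rightarrow> (real \<Rightarrow> real \<Rightarrow> real) \<Rightarrow> bool" where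
  "weak_identity m f u \<longleftrightarrow>
     (\<forall>r>0. \<forall>T>0. \<forall>\<psi> \<psi>t \<psi>x \<psi>xx.
        admissible (- r) r T \<psi> \<psi>t \<psi>x \<psi>xx \<longrightarrow> balance m f u (- r) r T \<psi> \<psi>t \<psi>xx)"

lemma closure_Q: "T > 0 \<Longrightarrow> closure (Q T) = {0..T} \<times> UNIV"
  by (simp add: Q_def closure_Times)

lemma admissible_iff_test_function:
  "T > 0 \<Longrightarrow> admissible (- r) r T \<psi> \<psi>t \<psi>x \<psi>xx \<longleftrightarrow> test_function r T \<psi> \<psi>t \<psi>x \<psi>xx"
  by (auto simp: admissible_def test_function_def closure_Q)

lemma C21_D:
  assumes "C21 T \<psi> \<psi>t \<psi>x \<psi>xx" and "T > 0"
  shows "\<And>t x. t \<in> {0..T} \<Longrightarrow> ((\<lambda>s. \<psi> s x) has_real_derivative \<psi>t t x) (at t within {0..T})"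
    "\<And>t x. t \<in> {0..T} \<Longrightarrow> ((\<lambda>y. \<psi> t y) has_real_derivative \<psi>x t x) (at x)"
    "\<And>t x. t \<in> {0..T} \<Longrightarrow> ((\<lambda>y. \<psi>x t y) has_real_derivative \<psi>xx t x) (at x)"
    "continuous_on ({0..T} \<times> UNIV) (\<lambda>(t, x). \<psi> t x)"
    "continuous_on ({0..T} \<times> UNIV) (\<lambda>(t, x). \<psi>t t x)"
    "continuous_on ({0..T} \<times> UNIV) (\<lambda>(t, x). \<psi>x t x)"
    "continuous_on ({0..T} \<times> UNIV) (\<lambda>(t, x). \<psi>xx t x)"
  using assms unfolding C21_def by (auto simp: closure_Q)

lemma C21_I:
  assumes "T > 0"
    and "\<And>t x. t \<in> {0..T} \<Longrightarrow> ((\<lambda>s. \<psi> s x) has_real_derivative \<psi>t t x) (at t within {0..T})"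
    "\<And>t x. t \<in> {0..T} \<Longrightarrow> ((\<lambda>y. \<psi> t y) has_real_derivative \<psi>x t x) (at x)"
    "\<And>t x. t \<in> {0..T} \<Longrightarrow> ((\<lambda>y. \<psi>x t y) has_real_derivative \<psi>xx t x) (at x)"
    "continuous_on ({0..T} \<times> UNIV) (\<lambda>(t, x). \<psi> t x)"
    "continuous_on ({0..T} \<times> UNIV) (\<lambda>(t, x). \<psi>t t x)"
    "continuous_on ({0..T} \<times> UNIV) (\<lambda>(t, x). \<psi>x t x)"
    "continuous_on ({0..T} \<times> UNIV) (\<lambda>(t, x). \<psi>xx t x)"
  shows "C21 T \<psi> \<psi>t \<psi>x \<psi>xx"
  using assms unfolding C21_def closure_Q[OF assms(1)] by blast

text \<open>A zero of the nonnegative function \<open>\<psi> t\<close> is a minimum over the whole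
  line, so the derivative vanishes there.\<close>

lemma admissible_slope_zero:
  assumes "admissible A B T \<psi> \<psi>t \<psi>x \<psi>xx" and t: "t \<in> {0..T}"
  shows "\<psi>x t A = 0" "\<psi>x t B = 0"
proof -
  have "\<psi>x t x = 0" if "\<psi> t x = 0" for x
  proof (rule DERIV_local_min[where f = "\<psi> t"])
    show "(\<psi> t has_real_derivative \<psi>x t x) (at x)"
      using assms unfolding admissible_def C21_def by auto
    show "\<forall>y. \<bar>x - y\<bar> < 1 \<longrightarrow> \<psi> t x \<le> \<psi> t y"
      using assms that unfolding admissible_def by auto
  qed simp
  then show "\<psi>x t A = 0" "\<psi>x t B = 0"
    using assms unfolding admissible_def by auto
qed

text \<open>Continuity up to t = 0 and the range [0, 1] supply every clause of a weak solution
  except the integral identity, with 1 as the essential bound. In that identity the lateral boundary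
  term is zero by \<open>admissible_slope_zero\<close>.\<close>

lemma weak_solution_iff_weak_identity:
  assumes cont: "continuous_on ({0..} \<times> UNIV) (\<lambda>(t, x). u t x)"
    and u: "\<And>t x. t \<ge> 0 \<Longrightarrow> 0 \<le> u t x \<and> u t x \<le> 1"
  shows "weak_solution m f (u 0) u \<longleftrightarrow> weak_identity m f u"
proof -
  have "continuous_on (Q T) (\<lambda>(t, x). u t x)" for T
    by (rule continuous_on_subset[OF cont]) (auto simp: Q_def)
  moreover have "continuous_on UNIV (u 0)"
    by (rule continuous_on_compose2[OF cont, of _ "\<lambda>x. (0, x)", simplified])
      (auto intro!: continuous_intros)
  moreover have "\<exists>K. AE (t, x) in lborel. (t, x) \<in> Q T \<longrightarrow> \<bar>u t x\<bar> \<le> K" for T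
    using u by (intro exI[of _ 1] always_eventually) (auto simp: Q_def)
  moreover have "integral {0..T} (\<lambda>t. u t r powr (m + 1) * \<psi>x t r
      - u t (- r) powr (m + 1) * \<psi>x t (- r)) = 0"
    if "admissible (- r) r T \<psi> \<psi>t \<psi>x \<psi>xx" for r T \<psi> \<psi>t \<psi>x \<psi>xx
    using admissible_slope_zero[OF that]
    by (intro integral_unique has_integral_is_0) auto
  ultimately show ?thesis
    using u unfolding weak_solution_def weak_identity_def balance_def integrand_def
    by (simp add: admissible_iff_test_function cong: imp_cong)
qed

section \<open>Boundary decay of test functions and localization to arbitrary intervals\<close>

text \<open>Both \<psi> and its slope vanish at the endpoints. Integrating the bound on \<psi>xx
  twice from the nearer endpoint E gives linear decay of the slope and quadratic decay of \<psi> in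
  |x - E|, and |x - E| is comparable to (x - A)(B - x).\<close>

lemma admissible_bounds:
  assumes adm: "admissible A B T \<psi> \<psi>t \<psi>x \<psi>xx" and "A < B" and "T > 0"
  obtains K where "K \<ge> 0"
    and "\<And>t x. t \<in> {0..T} \<Longrightarrow> x \<in> {A..B} \<Longrightarrow>
      \<bar>\<psi> t x\<bar> \<le> K * ((x - A) * (B - x)) ^ 2 \<and> \<bar>\<psi>x t x\<bar> \<le> K * ((x - A) * (B - x)) \<and>
      \<bar>\<psi>xx t x\<bar> \<le> K"
proof -
  have C: "C21 T \<psi> \<psi>t \<psi>x \<psi>xx" using adm by (simp add: admissible_def)
  note D = C21_D[OF C \<open>T > 0\<close>]
  have "compact ((\<lambda>(t, x). \<psi>xx t x) ` ({0..T} \<times> {A..B}))"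
    by (intro compact_continuous_image continuous_on_subset[OF D(7)] compact_Times) auto
  then obtain K where K: "\<And>t x. t \<in> {0..T} \<Longrightarrow> x \<in> {A..B} \<Longrightarrow> \<bar>\<psi>xx t x\<bar> \<le> K"
    by (fastforce dest!: compact_imp_bounded simp: bounded_iff)
  have K0: "K \<ge> 0" using K[of 0 A] \<open>A < B\<close> \<open>T > 0\<close> by auto
  \<comment> \<open>The farther endpoint is at distance at least (B - A)/2 = 1/L from
    \<open>x\<close>, so multiplying the smaller factor by \<open>L\<close> times the larger one
    does not decrease it.\<close>
  define L where "L = 2 / (B - A)"
  have L: "L > 0" using \<open>A < B\<close> by (simp add: L_def)
  \<comment> \<open>Two mean value estimates: first for the slope on \<open>{A..B}\<close>, then for
    \<psi> on the segment from E to x, where the slope is at most K |x - E|.\<close>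
  have est: "\<bar>\<psi> t x\<bar> \<le> K * \<bar>x - E\<bar> ^ 2 \<and> \<bar>\<psi>x t x\<bar> \<le> K * \<bar>x - E\<bar>"
    if t: "t \<in> {0..T}" and x: "x \<in> {A..B}" and E: "E = A \<or> E = B" for t x E
  proof -
    have z: "\<psi> t E = 0" "\<psi>x t E = 0"
      using admissible_slope_zero[OF adm t] E t adm unfolding admissible_def by auto
    have sub: "closed_segment E x \<subseteq> {A..B}"
      using E x \<open>A < B\<close> by (intro closed_segment_subset) auto
    have d1: "\<bar>\<psi>x t y\<bar> \<le> K * \<bar>y - E\<bar>" if "y \<in> {A..B}" for y
      using field_differentiable_bound[of "{A..B}" "\<psi>x t" "\<psi>xx t" K y E] has_field_derivative_at_within[OF D(3)[OF t]] K[OF t] that z E \<open>A < B\<close>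
      by auto
    have "\<bar>\<psi>x t y\<bar> \<le> K * \<bar>x - E\<bar>" if "y \<in> closed_segment E x" for y
    proof -
      have "\<bar>y - E\<bar> \<le> \<bar>x - E\<bar>"
        using that by (auto simp: closed_segment_eq_real_ivl split: if_splits)
      then show ?thesis
        using d1[of y] sub that K0 by (meson mult_left_mono order_trans subsetD)
    qed
    then have "\<bar>\<psi> t x - \<psi> t E\<bar> \<le> K * \<bar>x - E\<bar> * \<bar>x - E\<bar>"
      using field_differentiable_bound[of "closed_segment E x" "\<psi> t" "\<psi>x t" "K * \<bar>x - E\<bar>" x E]
        has_field_derivative_at_within[OF D(2)[OF t]]
      by auto
    then show ?thesis using z d1[OF x] by (simp add: power2_eq_square mult.assoc)
  qed
  have near: "\<exists>E. (E = A \<or> E = B) \<and> \<bar>x - E\<bar> \<le> L * ((x - A) * (B - x))" if x: "x \<in> {A..B}" for x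
  proof (cases "x - A \<le> B - x")
    case True
    then have "1 \<le> L * (B - x)" using \<open>A < B\<close> by (simp add: L_def field_simps)
    then have "(x - A) * 1 \<le> (x - A) * (L * (B - x))" using x by (intro mult_left_mono) auto
    then show ?thesis using x by (intro exI[of _ A]) (auto simp: mult_ac)
  next
    case False
    then have "1 \<le> L * (x - A)" using \<open>A < B\<close> by (simp add: L_def field_simps)
    then have "(B - x) * 1 \<le> (B - x) * (L * (x - A))" using x by (intro mult_left_mono) auto
    then show ?thesis using x by (intro exI[of _ B]) (auto simp: mult_ac)
  qed
  \<comment> \<open>One constant has to dominate K, K L and K L^2 at once, which the factor 1 + L +
    L^2 achieves.\<close>
  show thesis
  proof (rule that[of "K * (1 + L + L ^ 2)"])
    show "K * (1 + L + L ^ 2) \<ge> 0" using K0 L by simp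
    fix t x assume t: "t \<in> {0..T}" and x: "x \<in> {A..B}"
    define \<rho> where "\<rho> = (x - A) * (B - x)"
    have \<rho>: "\<rho> \<ge> 0" using x by (simp add: \<rho>_def)
    obtain E where E: "E = A \<or> E = B" "\<bar>x - E\<bar> \<le> L * \<rho>" using near[OF x] \<rho>_def by blast
    have "\<bar>\<psi> t x\<bar> \<le> K * (L * \<rho>) ^ 2"
      using est[OF t x E(1)] E(2) K0 by (meson abs_ge_zero mult_left_mono order_trans power_mono)
    also have "\<dots> = K * L ^ 2 * \<rho> ^ 2" by (simp add: power_mult_distrib)
    also have "\<dots> \<le> K * (1 + L + L ^ 2) * \<rho> ^ 2"
      using K0 L by (intro mult_right_mono mult_left_mono) auto
    finally have 1: "\<bar>\<psi> t x\<bar> \<le> K * (1 + L + L ^ 2) * \<rho> ^ 2" .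
    have "\<bar>\<psi>x t x\<bar> \<le> K * (L * \<rho>)"
      using est[OF t x E(1)] E(2) K0 by (meson mult_left_mono order_trans)
    also have "\<dots> = K * L * \<rho>" by simp
    also have "\<dots> \<le> K * (1 + L + L ^ 2) * \<rho>"
      using K0 L \<rho> by (intro mult_right_mono mult_left_mono) auto
    finally have 2: "\<bar>\<psi>x t x\<bar> \<le> K * (1 + L + L ^ 2) * \<rho>" .
    have "K * 1 \<le> K * (1 + L + L ^ 2)" using K0 L by (intro mult_left_mono) auto
    then have 3: "\<bar>\<psi>xx t x\<bar> \<le> K * (1 + L + L ^ 2)" using K[OF t x] by simp
    show "\<bar>\<psi> t x\<bar> \<le> K * (1 + L + L ^ 2) * ((x - A) * (B - x)) ^ 2 \<and>
        \<bar>\<psi>x t x\<bar> \<le> K * (1 + L + L ^ 2) * ((x - A) * (B - x)) \<and> \<bar>\<psi>xx t x\<bar> \<le> K * (1 + L + L ^ 2)"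
      using 1 2 3 unfolding \<rho>_def by blast
  qed
qed

text \<open>The quadratic \<rho> is positive exactly strictly between the endpoints, so one cutoff
  handles both ends and kills everything outside. The derivatives come from the product and chain
  rules with \<rho>' = A + B - 2x and \<rho>'' = -2.\<close>

lemma admissible_cut:
  fixes A B R :: real and n :: nat
  defines "\<rho> \<equiv> \<lambda>x. (x - A) * (B - x)"
  assumes adm: "admissible A B T \<psi> \<psi>t \<psi>x \<psi>xx" and "T > 0" and R: "\<bar>A\<bar> \<le> R" "\<bar>B\<bar> \<le> R"
  shows "admissible (- R) R T (\<lambda>t x. cut n (\<rho> x) * \<psi> t x) (\<lambda>t x. cut n (\<rho> x) * \<psi>t t x)
    (\<lambda>t x. cut1 n (\<rho> x) * (A + B - 2 * x) * \<psi> t x + cut n (\<rho> x) * \<psi>x t x)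
    (\<lambda>t x. (cut2 n (\<rho> x) * (A + B - 2 * x) ^ 2 - 2 * cut1 n (\<rho> x)) * \<psi> t x
      + 2 * (cut1 n (\<rho> x) * (A + B - 2 * x) * \<psi>x t x) + cut n (\<rho> x) * \<psi>xx t x)"
proof -
  have C: "C21 T \<psi> \<psi>t \<psi>x \<psi>xx" using adm by (simp add: admissible_def)
  note D = C21_D[OF C \<open>T > 0\<close>]
  have d\<rho>: "(\<rho> has_real_derivative (A + B - 2 * x)) (at x)" for x
    unfolding \<rho>_def by (auto intro!: derivative_eq_intros)
  have d0: "((\<lambda>x. cut n (\<rho> x)) has_real_derivative cut1 n (\<rho> x) * (A + B - 2 * x)) (at x)" for x
    by (rule DERIV_chain2[OF DERIV_cut d\<rho>])
  have d1: "((\<lambda>x. cut1 n (\<rho> x)) has_real_derivative cut2 n (\<rho> x) * (A + B - 2 * x)) (at x)" for x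
    by (rule DERIV_chain2[OF DERIV_cut1 d\<rho>])
  have c\<rho>: "continuous_on S (\<lambda>z. \<rho> (snd z))" for S :: "(real \<times> real) set"
    unfolding \<rho>_def by (intro continuous_intros)
  have c\<rho>': "continuous_on S (\<lambda>z. A + B - 2 * snd z)" for S :: "(real \<times> real) set"
    by (intro continuous_intros)
  have cont: "continuous_on ({0..T} \<times> UNIV) (\<lambda>z. \<psi> (fst z) (snd z))"
    "continuous_on ({0..T} \<times> UNIV) (\<lambda>z. \<psi>t (fst z) (snd z))"
    "continuous_on ({0..T} \<times> UNIV) (\<lambda>z. \<psi>x (fst z) (snd z))"
    "continuous_on ({0..T} \<times> UNIV) (\<lambda>z. \<psi>xx (fst z) (snd z))"
    using D(4-7) by (simp_all add: case_prod_beta)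
  \<comment> \<open>Neither R nor -R lies strictly between \<open>A\<close> and \<open>B\<close>, so
    the cutoff is zero at both.\<close>
  have "\<rho> (- R) \<le> 0" "\<rho> R \<le> 0"
    unfolding \<rho>_def using R by (auto simp: mult_le_0_iff)
  then have "cut n (\<rho> (- R)) = 0" "cut n (\<rho> R) = 0" by (simp_all add: cut_nonpos)
  moreover have "0 \<le> cut n (\<rho> x) * \<psi> t x" if "t \<in> {0..T}" for t x
    using adm that cut_bounds(1) unfolding admissible_def by simp
  moreover have "C21 T (\<lambda>t x. cut n (\<rho> x) * \<psi> t x) (\<lambda>t x. cut n (\<rho> x) * \<psi>t t x)
    (\<lambda>t x. cut1 n (\<rho> x) * (A + B - 2 * x) * \<psi> t x + cut n (\<rho> x) * \<psi>x t x)
    (\<lambda>t x. (cut2 n (\<rho> x) * (A + B - 2 * x) ^ 2 - 2 * cut1 n (\<rho> x)) * \<psi> t x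
      + 2 * (cut1 n (\<rho> x) * (A + B - 2 * x) * \<psi>x t x) + cut n (\<rho> x) * \<psi>xx t x)"
  proof (rule C21_I[OF \<open>T > 0\<close>], goal_cases)
    case (1 t x)
    show ?case by (rule DERIV_cmult[OF D(1)[OF 1]])
  next
    case (2 t x)
    show ?case
      by (rule derivative_eq_intros d0 D(2)[OF 2] refl)+ (simp add: algebra_simps)
  next
    case (3 t x)
    show ?case
      by (rule derivative_eq_intros d0 d1 D(2)[OF 3] D(3)[OF 3] refl)+
        (simp add: algebra_simps power2_eq_square)
  qed (unfold case_prod_beta, (intro continuous_on_add continuous_on_diff continuous_on_mult
        continuous_on_power continuous_on_const continuous_on_cut c\<rho> c\<rho>' cont)+)
  ultimately show ?thesis unfolding admissible_def by auto
qed

text \<open>The condition \<open>m > - 1\<close> makes the exponent m + 1 positive, so the power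
  stays continuous where \<open>u\<close> vanishes.\<close>

lemma continuous_on_integrand:
  assumes cont: "continuous_on ({0..} \<times> UNIV) (\<lambda>(t, x). u t x)"
    and u: "\<And>t x. t \<ge> 0 \<Longrightarrow> 0 \<le> u t x"
    and f: "continuous_on {0..} f" and "m > - 1" and C: "C21 T \<psi> \<psi>t \<psi>x \<psi>xx" and "T > 0"
  shows "continuous_on ({0..T} \<times> UNIV) (\<lambda>(t, x). integrand m f u \<psi> \<psi>t \<psi>xx t x)"
proof -
  let ?S = "{0..T} \<times> (UNIV :: real set)"
  have cu: "continuous_on ?S (\<lambda>z. u (fst z) (snd z))"
  proof -
    have "continuous_on ?S (\<lambda>(t, x). u t x)" by (rule continuous_on_subset[OF cont]) auto
    then show ?thesis by (simp add: case_prod_beta)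
  qed
  have "continuous_on ?S (\<lambda>z. u (fst z) (snd z) powr (m + 1))"
    using u \<open>m > - 1\<close> by (intro continuous_on_powr' cu continuous_on_const) auto
  moreover have "continuous_on ?S (\<lambda>z. f (u (fst z) (snd z)))"
    using u by (intro continuous_on_compose2[OF f cu]) auto
  ultimately show ?thesis
    using C21_D(4,5,7)[OF C \<open>T > 0\<close>] cu unfolding integrand_def case_prod_beta
    by (intro continuous_on_add continuous_on_mult continuous_on_const)
qed

lemma bounded_on_strip:
  fixes g :: "real \<Rightarrow> real \<Rightarrow> real"
  assumes "continuous_on ({0..T} \<times> UNIV) (\<lambda>(t, x). g t x)"
  obtains M where "M \<ge> 0" "\<And>t x. t \<in> {0..T} \<Longrightarrow> x \<in> {A..B} \<Longrightarrow> \<bar>g t x\<bar> \<le> M"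
proof -
  have "compact ((\<lambda>(t, x). g t x) ` ({0..T} \<times> {A..B}))"
    by (intro compact_continuous_image continuous_on_subset[OF assms] compact_Times) auto
  then obtain M where "\<And>t x. t \<in> {0..T} \<Longrightarrow> x \<in> {A..B} \<Longrightarrow> \<bar>g t x\<bar> \<le> M"
    by (fastforce dest!: compact_imp_bounded simp: bounded_iff)
  then show ?thesis by (intro that[of "max 0 M"]) (auto simp: le_max_iff_disj)
qed

text \<open>The hypothesis speaks of symmetric intervals only. It is applied on
  \<open>{- R..R}\<close> to \<psi> times a cutoff, whose integrals reduce to \<open>{A..B}\<close>,
  and then \<open>n\<close> tends to infinity. The derivatives of the cutoff are of order 1/\<rho>
  and 1/\<rho>^2, which the decay in \<open>admissible_bounds\<close> absorbs.\<close>

lemma weak_identity_balance: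
  assumes wi: "weak_identity m f u"
    and cont: "continuous_on ({0..} \<times> UNIV) (\<lambda>(t, x). u t x)"
    and u: "\<And>t x. t \<ge> 0 \<Longrightarrow> 0 \<le> u t x"
    and f: "continuous_on {0..} f" and m: "m > - 1"
    and adm: "admissible A B T \<psi> \<psi>t \<psi>x \<psi>xx" and "A < B" and "T > 0"
  shows "balance m f u A B T \<psi> \<psi>t \<psi>xx"
proof -
  define \<rho> where "\<rho> = (\<lambda>x. (x - A) * (B - x))"
  define R where "R = max \<bar>A\<bar> \<bar>B\<bar>"
  have R: "\<bar>A\<bar> \<le> R" "\<bar>B\<bar> \<le> R" "R > 0" "- R \<le> A" "B \<le> R" using \<open>A < B\<close> by (auto simp: R_def)
  define \<psi>' where "\<psi>' = (\<lambda>n t x. cut n (\<rho> x) * \<psi> t x)"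
  define \<psi>t' where "\<psi>t' = (\<lambda>n t x. cut n (\<rho> x) * \<psi>t t x)"
  define \<psi>xx' where "\<psi>xx' = (\<lambda>n t x. (cut2 n (\<rho> x) * (A + B - 2 * x) ^ 2 - 2 * cut1 n (\<rho> x)) * \<psi> t x
      + 2 * (cut1 n (\<rho> x) * (A + B - 2 * x) * \<psi>x t x) + cut n (\<rho> x) * \<psi>xx t x)"
  have adm': "\<exists>\<psi>x'. admissible (- R) R T (\<psi>' n) (\<psi>t' n) \<psi>x' (\<psi>xx' n)" for n
    using admissible_cut[OF adm \<open>T > 0\<close> R(1,2), of n] unfolding \<psi>'_def \<psi>t'_def \<psi>xx'_def \<rho>_def by blast
  have C: "C21 T \<psi> \<psi>t \<psi>x \<psi>xx" using adm by (simp add: admissible_def)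
  have \<rho>_out: "\<rho> x \<le> 0" if "x \<notin> {A..B}" for x
    using that \<open>A < B\<close> by (auto simp: \<rho>_def mult_le_0_iff)
  define F where "F = (\<lambda>n. integrand m f u (\<psi>' n) (\<psi>t' n) (\<psi>xx' n))"
  define H where "H = (\<lambda>x. u T x * \<psi> T x - u 0 x * \<psi> 0 x)"
  \<comment> \<open>The truncated test function and its derivatives vanish outside
    \<open>{A..B}\<close>, so both sides of the balance on \<open>{- R..R}\<close> restrict to
    \<open>{A..B}\<close>.\<close>
  have eq: "integral {0..T} (\<lambda>t. integral {A..B} (F n t)) = integral {A..B} (\<lambda>x. cut n (\<rho> x) * H x)" for n
  proof -
    have "balance m f u (- R) R T (\<psi>' n) (\<psi>t' n) (\<psi>xx' n)"
      using wi adm'[of n] R(3) \<open>T > 0\<close> unfolding weak_identity_def by blast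
    moreover have "integral {- R..R} (F n t) = integral {A..B} (F n t)" for t
      by (rule integral_zero_outside[OF _ R(4,5)])
        (use \<rho>_out cut_nonpos in \<open>simp add: F_def integrand_def \<psi>'_def \<psi>t'_def \<psi>xx'_def\<close>)
    moreover have "integral {- R..R} (\<lambda>x. cut n (\<rho> x) * H x) = integral {A..B} (\<lambda>x. cut n (\<rho> x) * H x)"
      by (rule integral_zero_outside[OF _ R(4,5)]) (use \<rho>_out cut_nonpos in simp)
    moreover have "(\<lambda>x. u T x * \<psi>' n T x - u 0 x * \<psi>' n 0 x) = (\<lambda>x. cut n (\<rho> x) * H x)"
      by (simp add: fun_eq_iff H_def \<psi>'_def algebra_simps)
    ultimately show ?thesis unfolding balance_def F_def by simp
  qed
  have cu: "continuous_on ({0..T} \<times> UNIV) (\<lambda>(t, x). u t x)"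
    by (rule continuous_on_subset[OF cont]) auto
  note D = C21_D[OF C \<open>T > 0\<close>]
  obtain U where U: "U \<ge> 0" "\<And>t x. t \<in> {0..T} \<Longrightarrow> x \<in> {A..B} \<Longrightarrow> \<bar>u t x\<bar> \<le> U"
    using bounded_on_strip[OF cu, of A B] by metis
  have "continuous_on ({0..T} \<times> UNIV) (\<lambda>(t, x). 1 / (m + 1) * u t x powr (m + 1))"
    using cu u m unfolding case_prod_beta
    by (intro continuous_on_mult continuous_on_powr' continuous_on_const) auto
  then obtain V where V: "V \<ge> 0"
      "\<And>t x. t \<in> {0..T} \<Longrightarrow> x \<in> {A..B} \<Longrightarrow> \<bar>1 / (m + 1) * u t x powr (m + 1)\<bar> \<le> V"
    using bounded_on_strip[of T "\<lambda>t x. 1 / (m + 1) * u t x powr (m + 1)"] by metis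
  have "continuous_on ({0..T} \<times> UNIV) (\<lambda>(t, x). f (u t x))"
    using cu u unfolding case_prod_beta by (intro continuous_on_compose2[OF f]) auto
  then obtain W where W: "W \<ge> 0" "\<And>t x. t \<in> {0..T} \<Longrightarrow> x \<in> {A..B} \<Longrightarrow> \<bar>f (u t x)\<bar> \<le> W"
    using bounded_on_strip[of T "\<lambda>t x. f (u t x)"] by metis
  obtain P where P: "P \<ge> 0" "\<And>t x. t \<in> {0..T} \<Longrightarrow> x \<in> {A..B} \<Longrightarrow> \<bar>\<psi> t x\<bar> \<le> P"
    using bounded_on_strip[OF D(4), of A B] by metis
  obtain Pt where Pt: "Pt \<ge> 0" "\<And>t x. t \<in> {0..T} \<Longrightarrow> x \<in> {A..B} \<Longrightarrow> \<bar>\<psi>t t x\<bar> \<le> Pt"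
    using bounded_on_strip[OF D(5), of A B] by metis
  obtain K where K: "K \<ge> 0" "\<And>t x. t \<in> {0..T} \<Longrightarrow> x \<in> {A..B} \<Longrightarrow>
      \<bar>\<psi> t x\<bar> \<le> K * \<rho> x ^ 2 \<and> \<bar>\<psi>x t x\<bar> \<le> K * \<rho> x \<and> \<bar>\<psi>xx t x\<bar> \<le> K"
    using admissible_bounds[OF adm \<open>A < B\<close> \<open>T > 0\<close>] unfolding \<rho>_def by metis
  define l where "l = B - A"
  \<comment> \<open>The summands bound the four terms of \<open>\<psi>xx'\<close> in the order of
    its expansion below: 24 is from \<open>cut2_bound\<close>, each 6 is twice the 3 of
    \<open>cut1_bound\<close>. The powers of \<open>l\<close> bound \<rho>' in the first and third
    terms and a spare factor \<rho> \<le> l^2 in the second.\<close>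
  define M where "M = 24 * K * l ^ 2 + 6 * K * l ^ 2 + 6 * K * l + K"
  have cut_le: "\<bar>cut n y * v\<bar> \<le> w" if "\<bar>v\<bar> \<le> w" for n y v w
    using that mult_mono[of "\<bar>cut n y\<bar>" 1 "\<bar>v\<bar>" w] cut_bounds[of n y] by (simp add: abs_mult)
  have bxx: "\<bar>\<psi>xx' n t x\<bar> \<le> M" if t: "t \<in> {0..T}" and x: "x \<in> {A..B}" for n t x
  proof -
    have \<rho>: "0 \<le> \<rho> x" "\<rho> x \<le> l * l"
      using x unfolding \<rho>_def l_def by (auto intro!: mult_mono)
    have ax: "\<bar>A + B - 2 * x\<bar> \<le> l" using x by (auto simp: l_def)
    have l0: "l \<ge> 0" using \<open>A < B\<close> by (simp add: l_def)
    have a: "\<bar>cut2 n (\<rho> x) * \<psi> t x\<bar> \<le> K * 24"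
    proof -
      have "\<bar>cut2 n (\<rho> x) * \<psi> t x\<bar> \<le> \<bar>cut2 n (\<rho> x)\<bar> * (K * \<rho> x ^ 2)"
        unfolding abs_mult using K(2)[OF t x] by (intro mult_left_mono) auto
      also have "\<dots> = K * \<bar>\<rho> x ^ 2 * cut2 n (\<rho> x)\<bar>" by (simp add: abs_mult)
      also have "\<dots> \<le> K * 24" using K(1) cut2_bound by (intro mult_left_mono)
      finally show ?thesis .
    qed
    have b: "\<bar>cut1 n (\<rho> x) * \<psi>x t x\<bar> \<le> K * 3"
    proof -
      have "\<bar>cut1 n (\<rho> x) * \<psi>x t x\<bar> \<le> \<bar>cut1 n (\<rho> x)\<bar> * (K * \<rho> x)"
        unfolding abs_mult using K(2)[OF t x] by (intro mult_left_mono) auto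
      also have "\<dots> = K * \<bar>\<rho> x * cut1 n (\<rho> x)\<bar>" using \<rho> by (simp add: abs_mult)
      also have "\<dots> \<le> K * 3" using K(1) cut1_bound by (intro mult_left_mono)
      finally show ?thesis .
    qed
    \<comment> \<open>Only one of the two factors \<rho> is spent on \<open>cut1\<close>; the other
      is bounded by l^2.\<close>
    have c: "\<bar>cut1 n (\<rho> x) * \<psi> t x\<bar> \<le> K * 3 * (l * l)"
    proof -
      have "\<bar>cut1 n (\<rho> x) * \<psi> t x\<bar> \<le> \<bar>cut1 n (\<rho> x)\<bar> * (K * \<rho> x ^ 2)"
        unfolding abs_mult using K(2)[OF t x] by (intro mult_left_mono) auto
      also have "\<dots> = K * \<bar>\<rho> x * cut1 n (\<rho> x)\<bar> * \<rho> x" using \<rho> by (simp add: abs_mult power2_eq_square)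
      also have "\<dots> \<le> K * 3 * (l * l)"
        using K(1) \<rho> cut1_bound by (intro mult_mono) auto
      finally show ?thesis .
    qed
    have "\<bar>cut2 n (\<rho> x) * \<psi> t x * (A + B - 2 * x) ^ 2\<bar> \<le> K * 24 * l ^ 2"
      using a ax K(1) l0 unfolding abs_mult[of _ "_ ^ 2"] power_abs
      by (intro mult_mono power_mono) auto
    moreover have "\<bar>cut1 n (\<rho> x) * \<psi>x t x * (A + B - 2 * x)\<bar> \<le> K * 3 * l"
      using b ax K(1) l0 unfolding abs_mult[of _ "A + B - 2 * x"] by (intro mult_mono) auto
    moreover have "\<bar>cut n (\<rho> x) * \<psi>xx t x\<bar> \<le> K" using K(2)[OF t x] by (intro cut_le) auto
    moreover have "\<psi>xx' n t x = cut2 n (\<rho> x) * \<psi> t x * (A + B - 2 * x) ^ 2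
        - 2 * (cut1 n (\<rho> x) * \<psi> t x) + 2 * (cut1 n (\<rho> x) * \<psi>x t x * (A + B - 2 * x))
        + cut n (\<rho> x) * \<psi>xx t x"
      by (simp add: \<psi>xx'_def algebra_simps)
    moreover have "K * 3 * (l * l) = 3 * (K * l ^ 2)" by (simp add: power2_eq_square)
    ultimately show ?thesis using c unfolding M_def by linarith
  qed
  have "(\<lambda>n. integral {0..T} (\<lambda>t. integral {A..B} (F n t)))
      \<longlonglongrightarrow> integral {0..T} (\<lambda>t. integral {A..B} (integrand m f u \<psi> \<psi>t \<psi>xx t))"
  proof (rule iterated_dominated_convergence)
    show "continuous_on ({0..T} \<times> {A..B}) (\<lambda>(t, x). F n t x)" for n
    proof -
      obtain \<psi>x' where "admissible (- R) R T (\<psi>' n) (\<psi>t' n) \<psi>x' (\<psi>xx' n)" using adm' by blast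
      then have C': "C21 T (\<psi>' n) (\<psi>t' n) \<psi>x' (\<psi>xx' n)" by (simp add: admissible_def)
      show ?thesis unfolding F_def
        by (rule continuous_on_subset[OF continuous_on_integrand[OF cont u f m C' \<open>T > 0\<close>]]) auto
    qed
    show "\<bar>F n t x\<bar> \<le> U * Pt + V * M + W * P" if t: "t \<in> {0..T}" and x: "x \<in> {A..B}" for n t x
    proof -
      have "\<bar>u t x * \<psi>t' n t x\<bar> \<le> U * Pt"
        unfolding abs_mult using U Pt(1) cut_le[OF Pt(2)[OF t x]] t x
        by (intro mult_mono) (auto simp: \<psi>t'_def)
      moreover have "\<bar>1 / (m + 1) * u t x powr (m + 1) * \<psi>xx' n t x\<bar> \<le> V * M"
        unfolding abs_mult[of _ "\<psi>xx' n t x"] using V bxx t x by (intro mult_mono) auto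
      moreover have "\<bar>f (u t x) * \<psi>' n t x\<bar> \<le> W * P"
        unfolding abs_mult using W P(1) cut_le[OF P(2)[OF t x]] t x
        by (intro mult_mono) (auto simp: \<psi>'_def)
      ultimately show ?thesis unfolding F_def integrand_def by linarith
    qed
    show "(\<lambda>n. F n t x) \<longlonglongrightarrow> integrand m f u \<psi> \<psi>t \<psi>xx t x" if "x \<in> {A<..<B}" for t x
    proof -
      have \<rho>: "\<rho> x > 0" using that by (simp add: \<rho>_def)
      note L = cut_tendsto[OF \<rho>]
      \<comment> \<open>Inside the interval \<open>cut\<close> tends to 1 and \<open>cut1\<close>,
        \<open>cut2\<close> tend to 0; the limits are written out term by term.\<close>
      have "(\<lambda>n. F n t x) \<longlonglongrightarrow> u t x * (1 * \<psi>t t x) + 1 / (m + 1) * u t x powr (m + 1)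
          * ((0 * (A + B - 2 * x) ^ 2 - 2 * 0) * \<psi> t x + 2 * (0 * (A + B - 2 * x) * \<psi>x t x)
            + 1 * \<psi>xx t x) + f (u t x) * (1 * \<psi> t x)"
        unfolding F_def integrand_def \<psi>'_def \<psi>t'_def \<psi>xx'_def
        by (intro tendsto_add tendsto_mult tendsto_diff tendsto_const L)
      then show ?thesis by (simp add: integrand_def)
    qed
  qed (use \<open>A < B\<close> in auto)
  moreover have "(\<lambda>n. integral {A..B} (\<lambda>x. cut n (\<rho> x) * H x)) \<longlonglongrightarrow> integral {A..B} H"
  proof (rule interval_dominated_convergence)
    have slice: "continuous_on {A..B} (\<lambda>x. g t x)"
      if "continuous_on ({0..T} \<times> UNIV) (\<lambda>(t, x). g t x)" "t \<in> {0..T}" for g :: "real \<Rightarrow> real \<Rightarrow> real" and t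
      by (rule continuous_on_compose2[OF that(1), of _ "\<lambda>x. (t, x)", simplified])
        (use that in \<open>auto intro!: continuous_intros\<close>)
    have "continuous_on {A..B} H"
      unfolding H_def using \<open>T > 0\<close>
      by (intro continuous_on_diff continuous_on_mult slice[OF cu] slice[OF D(4)]) auto
    then show "continuous_on {A..B} (\<lambda>x. cut n (\<rho> x) * H x)" for n
      unfolding \<rho>_def by (intro continuous_intros continuous_on_cut)
    show "\<bar>cut n (\<rho> x) * H x\<bar> \<le> U * P + U * P" if "x \<in> {A..B}" for n x
    proof (rule cut_le)
      have "\<bar>u t x * \<psi> t x\<bar> \<le> U * P" if "t \<in> {0..T}" for t
        unfolding abs_mult using U P that \<open>x \<in> _\<close> by (intro mult_mono) auto
      then have "\<bar>u 0 x * \<psi> 0 x\<bar> \<le> U * P" "\<bar>u T x * \<psi> T x\<bar> \<le> U * P"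
        using \<open>T > 0\<close> by simp_all
      then show "\<bar>H x\<bar> \<le> U * P + U * P" unfolding H_def by linarith
    qed
    show "(\<lambda>n. cut n (\<rho> x) * H x) \<longlonglongrightarrow> H x" if "x \<in> {A<..<B}" for x
      using tendsto_mult[OF cut_tendsto(1) tendsto_const, of "\<rho> x" "H x"] that by (simp add: \<rho>_def)
  qed
  \<comment> \<open>By \<open>eq\<close> the two limits belong to the same sequence, so they
    agree.\<close>
  ultimately show ?thesis
    unfolding balance_def eq H_def by (rule LIMSEQ_unique)
qed

section \<open>Invariance under translation and reflection in space\<close>

lemma continuous_on_strip_compose:
  fixes g :: "real \<Rightarrow> real \<Rightarrow> real"
  assumes g: "continuous_on (I \<times> UNIV) (\<lambda>(t, x). g t x)" and h: "continuous_on UNIV h"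
  shows "continuous_on (I \<times> UNIV) (\<lambda>(t, x). g t (h x))"
proof -
  have "continuous_on (I \<times> UNIV) (\<lambda>z. (fst z, h (snd z)))"
    by (intro continuous_intros continuous_on_compose2[OF h]) auto
  then have "continuous_on (I \<times> UNIV) (\<lambda>z. case (fst z, h (snd z)) of (t, x) \<Rightarrow> g t x)"
    by (rule continuous_on_compose2[OF g]) auto
  then show ?thesis by (simp add: case_prod_beta)
qed

lemma admissible_translate:
  assumes "admissible A B T \<psi> \<psi>t \<psi>x \<psi>xx" and T: "T > 0"
  shows "admissible (A - s) (B - s) T (\<lambda>t x. \<psi> t (x + s)) (\<lambda>t x. \<psi>t t (x + s))
    (\<lambda>t x. \<psi>x t (x + s)) (\<lambda>t x. \<psi>xx t (x + s))"
proof -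
  have C: "C21 T \<psi> \<psi>t \<psi>x \<psi>xx" using assms by (simp add: admissible_def)
  note D = C21_D[OF C T]
  have *: "continuous_on ({0..T} \<times> UNIV) (\<lambda>(t, x). g t (x + s))"
    if "continuous_on ({0..T} \<times> UNIV) (\<lambda>(t, x). g t x)" for g :: "real \<Rightarrow> real \<Rightarrow> real"
    by (rule continuous_on_strip_compose[OF that]) (intro continuous_intros)
  have "C21 T (\<lambda>t x. \<psi> t (x + s)) (\<lambda>t x. \<psi>t t (x + s)) (\<lambda>t x. \<psi>x t (x + s)) (\<lambda>t x. \<psi>xx t (x + s))"
    by (rule C21_I[OF T D(1) DERIV_shift[THEN iffD1, OF D(2)] DERIV_shift[THEN iffD1, OF D(3)]
          *[OF D(4)] *[OF D(5)] *[OF D(6)] *[OF D(7)]])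
  then show ?thesis using assms(1) unfolding admissible_def by auto
qed

text \<open>Reflection changes the sign of the slope and, applied twice, leaves the second
  derivative unchanged in sign. The slope does not enter \<open>balance\<close>.\<close>

lemma admissible_reflect:
  assumes "admissible A B T \<psi> \<psi>t \<psi>x \<psi>xx" and T: "T > 0"
  shows "admissible (- B) (- A) T (\<lambda>t x. \<psi> t (- x)) (\<lambda>t x. \<psi>t t (- x))
    (\<lambda>t x. - \<psi>x t (- x)) (\<lambda>t x. \<psi>xx t (- x))"
proof -
  have C: "C21 T \<psi> \<psi>t \<psi>x \<psi>xx" using assms by (simp add: admissible_def)
  note D = C21_D[OF C T]
  have *: "continuous_on ({0..T} \<times> UNIV) (\<lambda>(t, x). g t (- x))"
    if "continuous_on ({0..T} \<times> UNIV) (\<lambda>(t, x). g t x)" for g :: "real \<Rightarrow> real \<Rightarrow> real"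
    by (rule continuous_on_strip_compose[OF that]) (intro continuous_intros)
  have "C21 T (\<lambda>t x. \<psi> t (- x)) (\<lambda>t x. \<psi>t t (- x)) (\<lambda>t x. - \<psi>x t (- x)) (\<lambda>t x. \<psi>xx t (- x))"
  proof (rule C21_I[OF T])
    show "((\<lambda>y. - \<psi>x t (- y)) has_real_derivative \<psi>xx t (- x)) (at x)" if "t \<in> {0..T}" for t x
      using DERIV_minus[OF DERIV_mirror[THEN iffD1, OF D(3)[OF that]]] by simp
    show "continuous_on ({0..T} \<times> UNIV) (\<lambda>(t, x). - \<psi>x t (- x))"
      using continuous_on_minus[OF *[OF D(6)]] by (simp add: case_prod_beta)
  qed (rule D(1) DERIV_mirror[THEN iffD1, OF D(2)] *[OF D(4)] *[OF D(5)] *[OF D(7)]; assumption)+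
  then show ?thesis using assms(1) unfolding admissible_def by auto
qed

text \<open>Substituting x + s for x moves the shift from \<open>u\<close> to the test function,
  which now lives on the asymmetric interval \<open>{- r - s..r - s}\<close>. There
  \<open>weak_identity_balance\<close> provides the identity.\<close>

lemma weak_identity_translate:
  assumes "weak_identity m f u" and "continuous_on ({0..} \<times> UNIV) (\<lambda>(t, x). u t x)"
    and "\<And>t x. t \<ge> 0 \<Longrightarrow> 0 \<le> u t x" and "continuous_on {0..} f" and "m > - 1"
  shows "weak_identity m f (\<lambda>t x. u t (x - s))"
  unfolding weak_identity_def
proof (intro allI impI)
  fix r T \<psi> \<psi>t \<psi>x \<psi>xx
  assume r: "r > (0::real)" and T: "T > (0::real)" and adm: "admissible (- r) r T \<psi> \<psi>t \<psi>x \<psi>xx"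
  have "balance m f u (- r - s) (r - s) T (\<lambda>t x. \<psi> t (x + s)) (\<lambda>t x. \<psi>t t (x + s)) (\<lambda>t x. \<psi>xx t (x + s))"
    by (rule weak_identity_balance[OF assms admissible_translate[OF adm T]]) (use r T in auto)
  moreover have "integral {- r - s..r - s} (\<lambda>x. g (x + s)) = integral {- r..r} g" for g :: "real \<Rightarrow> real"
    by (rule integral_shift_real_ivl)
  \<comment> \<open>The placeholder keeps the time free, so the substitution can be rewritten under
    the outer integral.\<close>
  note this[of "integrand m f (\<lambda>t x. u t (x - s)) \<psi> \<psi>t \<psi>xx _"]
    this[of "\<lambda>x. u T (x - s) * \<psi> T x - u 0 (x - s) * \<psi> 0 x"]
  ultimately show "balance m f (\<lambda>t x. u t (x - s)) (- r) r T \<psi> \<psi>t \<psi>xx"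
    unfolding balance_def integrand_def by simp
qed

text \<open>The interval \<open>{- r..r}\<close> is mapped to itself, so the identity for the
  reflected test function can be used directly.\<close>

lemma weak_identity_reflect:
  assumes "weak_identity m f u"
  shows "weak_identity m f (\<lambda>t x. u t (- x))"
  unfolding weak_identity_def
proof (intro allI impI)
  fix r T \<psi> \<psi>t \<psi>x \<psi>xx
  assume r: "r > (0::real)" and T: "T > (0::real)" and adm: "admissible (- r) r T \<psi> \<psi>t \<psi>x \<psi>xx"
  have "balance m f u (- r) r T (\<lambda>t x. \<psi> t (- x)) (\<lambda>t x. \<psi>t t (- x)) (\<lambda>t x. \<psi>xx t (- x))"
    using assms admissible_reflect[OF adm T] r T unfolding weak_identity_def by force
  moreover have "integral {- r..r} (\<lambda>x. g (- x)) = integral {- r..r} g" for g :: "real \<Rightarrow> real"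
    using Henstock_Kurzweil_Integration.integral_reflect_real[of r "- r" g] by simp
  note this[of "integrand m f (\<lambda>t x. u t (- x)) \<psi> \<psi>t \<psi>xx _"]
    this[of "\<lambda>x. u T (- x) * \<psi> T x - u 0 (- x) * \<psi> 0 x"]
  ultimately show "balance m f (\<lambda>t x. u t (- x)) (- r) r T \<psi> \<psi>t \<psi>xx"
    unfolding balance_def integrand_def by simp
qed

section \<open>Superposition of solutions with disjoint positivity sets\<close>

text \<open>Where one summand is 0, the power and \<open>f\<close> are additive because both vanish
  at 0. Hence the integrands add pointwise, and continuity allows the integrals to be split.\<close>

lemma weak_identity_add:
  assumes u: "weak_identity m f u" "continuous_on ({0..} \<times> UNIV) (\<lambda>(t, x). u t x)"
      "\<And>t x. t \<ge> 0 \<Longrightarrow> 0 \<le> u t x"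
    and v: "weak_identity m f v" "continuous_on ({0..} \<times> UNIV) (\<lambda>(t, x). v t x)"
      "\<And>t x. t \<ge> 0 \<Longrightarrow> 0 \<le> v t x"
    and disj: "\<And>t x. t \<ge> 0 \<Longrightarrow> u t x = 0 \<or> v t x = 0"
    and f: "continuous_on {0..} f" "f 0 = 0" and m: "m > - 1"
  shows "weak_identity m f (\<lambda>t x. u t x + v t x)"
  unfolding weak_identity_def
proof (intro allI impI)
  fix r T \<psi> \<psi>t \<psi>x \<psi>xx
  assume r: "r > (0::real)" and T: "T > (0::real)" and adm: "admissible (- r) r T \<psi> \<psi>t \<psi>x \<psi>xx"
  have C: "C21 T \<psi> \<psi>t \<psi>x \<psi>xx" using adm by (simp add: admissible_def)
  have bal: "balance m f u (- r) r T \<psi> \<psi>t \<psi>xx" "balance m f v (- r) r T \<psi> \<psi>t \<psi>xx"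
    using u(1)[unfolded weak_identity_def, rule_format, OF r T adm]
      v(1)[unfolded weak_identity_def, rule_format, OF r T adm] .
  have slice: "continuous_on {- r..r} (g t)"
    if "continuous_on ({0..T} \<times> UNIV) (\<lambda>(t, x). g t x)" "t \<in> {0..T}" for g :: "real \<Rightarrow> real \<Rightarrow> real" and t
    by (rule continuous_on_compose2[OF that(1), of _ "\<lambda>x. (t, x)", simplified])
      (use that in \<open>auto intro!: continuous_intros\<close>)
  \<comment> \<open>The inner integral depends continuously on \<open>t\<close>, as its integrand is
    continuous on a compact rectangle.\<close>
  have int_t: "(\<lambda>t. integral {- r..r} (g t)) integrable_on {0..T}"
    if "continuous_on ({0..T} \<times> UNIV) (\<lambda>(t, x). g t x)" for g :: "real \<Rightarrow> real \<Rightarrow> real"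
  proof -
    have "continuous_on ({0..T} \<times> cbox (- r) r) (\<lambda>(t, x). g t x)"
      by (rule continuous_on_subset[OF that]) auto
    from integral_continuous_on_param[OF this] show ?thesis
      by (intro integrable_continuous_real) simp
  qed
  let ?I = "\<lambda>w. integrand m f w \<psi> \<psi>t \<psi>xx" and ?E = "\<lambda>w x. w T x * \<psi> T x - w 0 x * \<psi> 0 x"
  note cu = continuous_on_integrand[OF u(2,3) f(1) m C T] and cv = continuous_on_integrand[OF v(2,3) f(1) m C T]
  have I: "?I (\<lambda>t x. u t x + v t x) t x = ?I u t x + ?I v t x" if "t \<in> {0..T}" for t x
  proof -
    have "u t x = 0 \<or> v t x = 0" using disj that by simp
    then show ?thesis using f(2) by (elim disjE) (simp_all add: integrand_def algebra_simps)
  qed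
  have "integral {0..T} (\<lambda>t. integral {- r..r} (?I (\<lambda>t x. u t x + v t x) t))
      = integral {0..T} (\<lambda>t. integral {- r..r} (?I u t) + integral {- r..r} (?I v t))"
  proof (rule integral_cong)
    fix t assume t: "t \<in> {0..T}"
    show "integral {- r..r} (?I (\<lambda>t x. u t x + v t x) t) = integral {- r..r} (?I u t) + integral {- r..r} (?I v t)"
      unfolding I[OF t, abs_def]
      by (intro Henstock_Kurzweil_Integration.integral_add integrable_continuous_real slice[OF cu t] slice[OF cv t])
  qed
  also have "\<dots> = integral {0..T} (\<lambda>t. integral {- r..r} (?I u t)) + integral {0..T} (\<lambda>t. integral {- r..r} (?I v t))"
    by (rule Henstock_Kurzweil_Integration.integral_add[OF int_t[OF cu] int_t[OF cv]])
  also have "\<dots> = integral {- r..r} (?E u) + integral {- r..r} (?E v)"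
    using bal unfolding balance_def by simp
  also have "\<dots> = integral {- r..r} (\<lambda>x. ?E u x + ?E v x)"
  proof -
    have E: "continuous_on {- r..r} (?E w)" if "continuous_on ({0..} \<times> UNIV) (\<lambda>(t, x). w t x)" for w
    proof -
      have cw: "continuous_on ({0..T} \<times> UNIV) (\<lambda>(t, x). w t x)"
        by (rule continuous_on_subset[OF that]) auto
      show ?thesis
        using T by (intro continuous_on_diff continuous_on_mult slice[OF cw] slice[OF C21_D(4)[OF C T]]) auto
    qed
    show ?thesis
      by (rule Henstock_Kurzweil_Integration.integral_add[symmetric])
        (rule integrable_continuous_real, rule E, rule u(2) v(2))+
  qed
  also have "(\<lambda>x. ?E u x + ?E v x) = ?E (\<lambda>t x. u t x + v t x)"
    by (simp add: fun_eq_iff algebra_simps)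
  finally show "balance m f (\<lambda>t x. u t x + v t x) (- r) r T \<psi> \<psi>t \<psi>xx"
    unfolding balance_def .
qed

section \<open>The pair of counter-propagating waves\<close>

lemma continuous_on_reaction: "p > 0 \<Longrightarrow> continuous_on {0..} (reaction p a)"
  unfolding reaction_def by (intro continuous_intros continuous_on_powr') auto

text \<open>The zero profile is treated separately: its support is empty, so the infimum carries no
  information, but every translate is 0.\<close>

lemma normalized_eq_0:
  assumes "\<forall>\<xi>\<le>w0. \<phi> \<xi> = 0" and "\<xi> < w"
  shows "normalized \<phi> w \<xi> = 0"
proof (cases "\<exists>\<xi>. \<phi> \<xi> \<noteq> 0")
  case True
  then show ?thesis
    unfolding normalized_def by (rule Inf_fsupport(2)[OF _ assms(1)]) (use assms(2) in auto)
qed (simp add: normalized_def)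

theorem corollary4p4:
  fixes m p a c w1 w2 :: real and \<phi> :: "real \<Rightarrow> real"
  assumes "m > 0" and "p > 0" and "m + p = 1" and "0 < a" and "a < 1" and "c > 0"
    and "finite_traveling_wave m (reaction p a) c \<phi>"
    and "\<exists>w. \<forall>\<xi>\<le>w. \<phi> \<xi> = 0"
    and "w1 + w2 > 0"
  shows "weak_solution m (reaction p a) (wave_pair \<phi> c w1 w2 0) (wave_pair \<phi> c w1 w2)"
proof -
  let ?f = "reaction p a"
  define U where "U = (\<lambda>t x. \<phi> (x - c * t))"
  \<comment> \<open>The shift that normalizes: \<open>normalized \<phi> w\<close> is \<phi>
    translated by \<open>s w\<close>. Both waves thus arise from the single solution
    \<open>U\<close>, the second one by a further reflection.\<close>
  define s where "s = (\<lambda>w. w - Inf (fsupport \<phi>))"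
  define u v where "u = (\<lambda>t x. U t (x - s w1))" and "v = (\<lambda>t x. U t (- x - s w2))"
  have U0: "U 0 = \<phi>" by (simp add: U_def)
  have ws: "weak_solution m ?f (U 0) U"
    using assms(7) unfolding U0 by (simp add: finite_traveling_wave_def U_def)
  \<comment> \<open>The profile is itself the initial datum, so the conditions on initial data give
    its continuity and its range.\<close>
  then have \<phi>: "continuous_on UNIV \<phi>" "\<And>x. 0 \<le> \<phi> x \<and> \<phi> x \<le> 1"
    unfolding weak_solution_def U0 by blast+
  have f: "continuous_on {0..} ?f" "?f 0 = 0"
    using continuous_on_reaction[OF \<open>p > 0\<close>] by (simp_all add: reaction_def)
  have m: "m > - 1" using \<open>m > 0\<close> by simp
  have range: "0 \<le> U t x \<and> U t x \<le> 1" for t x using \<phi>(2) by (simp add: U_def)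
  have comp: "continuous_on S (\<lambda>(t, x). \<phi> (g t x))"
    if "continuous_on S (\<lambda>(t, x). g t x)" for S and g :: "real \<Rightarrow> real \<Rightarrow> real"
    using continuous_on_compose2[OF \<phi>(1) that] by (simp add: case_prod_beta)
  have cont: "continuous_on S (\<lambda>(t, x). U t x)" "continuous_on S (\<lambda>(t, x). U t (x - b))"
    "continuous_on S (\<lambda>(t, x). u t x)" "continuous_on S (\<lambda>(t, x). v t x)" for S b
    unfolding U_def u_def v_def by (intro comp; auto simp: case_prod_beta intro!: continuous_intros)+
  have shifted: "weak_identity m ?f (\<lambda>t x. U t (x - b))" for b
    using weak_identity_translate[OF _ cont(1) _ f(1) m, of b] ws range
      weak_solution_iff_weak_identity[OF cont(1) range, of m ?f] by blast
  have wi: "weak_identity m ?f u" "weak_identity m ?f v"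
    using shifted[of "s w1"] weak_identity_reflect[OF shifted[of "s w2"]] by (simp_all add: u_def v_def)
  have pair: "wave_pair \<phi> c w1 w2 = (\<lambda>t x. u t x + v t x)"
    by (simp add: fun_eq_iff wave_pair_def normalized_def reflected_def u_def v_def U_def s_def algebra_simps)
  obtain w0 where w0: "\<forall>\<xi>\<le>w0. \<phi> \<xi> = 0" using assms(8) by blast
  have disj: "u t x = 0 \<or> v t x = 0" if "t \<ge> 0" for t x
  proof -
    have "c * t \<ge> 0" using that \<open>c > 0\<close> by simp
    \<comment> \<open>Otherwise adding the two reverse inequalities gives -2ct \<ge> w1 + w2 > 0,
      against ct \<ge> 0.\<close>
    then have "x - c * t < w1 \<or> - x - c * t < w2" using \<open>w1 + w2 > 0\<close> by linarith
    moreover have "u t x = normalized \<phi> w1 (x - c * t)" "v t x = normalized \<phi> w2 (- x - c * t)"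
      by (simp_all add: normalized_def u_def v_def U_def s_def algebra_simps)
    ultimately show ?thesis using normalized_eq_0[OF w0] by auto
  qed
  have uv: "0 \<le> u t x \<and> u t x \<le> 1" "0 \<le> v t x \<and> v t x \<le> 1" for t x
    using range by (simp_all add: u_def v_def)
  have "weak_identity m ?f (wave_pair \<phi> c w1 w2)"
    unfolding pair by (rule weak_identity_add) (use wi cont uv disj f m in auto)
  moreover have "continuous_on ({0..} \<times> UNIV) (\<lambda>(t, x). wave_pair \<phi> c w1 w2 t x)"
    unfolding pair using continuous_on_add[OF cont(3,4)] by (simp add: case_prod_beta)
  \<comment> \<open>The upper bound 1 survives the addition because at each point one of the waves
    vanishes; at t = 0 it is the condition on the initial datum.\<close>
  moreover have "0 \<le> wave_pair \<phi> c w1 w2 t x \<and> wave_pair \<phi> c w1 w2 t x \<le> 1" if "t \<ge> 0" for t x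
    using disj[OF that, of x] uv[of t x] unfolding pair by auto
  ultimately show ?thesis by (subst weak_solution_iff_weak_identity)
qed

end
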